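(* Let $p_{-2},p_{-1},p_0,p_1,p_2,p_3\in\mathbb{R}$ be six reference scalars, placed at the integer positions $-2,-1,0,1,2,3$ respectively. Let $q_A,q_B,q_C,q_D$ be the values at positions $-3/2,-1/2,3/2,5/2$ respectively of the polynomial of degree at most $5$ interpolating these data, that is $$q_A=\tfrac{1}{256}(63p_{-2}+315p_{-1}-210p_0+126p_1-45p_2+7p_3),$$ $$q_B=\tfrac{1}{256}(-7p_{-2}+105p_{-1}+210p_0-70p_1+21p_2-3p_3),$$ $$q_C=\tfrac{1}{256}(-3p_{-2}+21p_{-1}-70p_0+210p_1+105p_2-7p_3),$$ $$q_D=\tfrac{1}{256}(7p_{-2}-45p_{-1}+126p_0-210p_1+315p_2+63p_3).$$ For $q\in\mathbb{R}$ (a new value to be placed at position $1/2$), set $$x_0=p_{-2},\ x_1=q_A,\ x_2=p_{-1},\ x_3=q_B,\ x_4=p_0,\ x_5=q,\ x_6=p_1,\ x_7=q_C,\ x_8=p_2,\ x_9=q_D,\ x_{10}=p_3,$$ let $\kappa_k=4(x_{k+1}-2x_k+x_{k-1})$, and define $$E(q)=(\kappa_4-\kappa_3)^2+(\kappa_5-\kappa_4)^2+(\kappa_6-\kappa_5)^2+(\kappa_7-\kappa_6)^2 .$$ Then $E$ is a strictly convex quadratic function of $q$, and its unique minimiser is $$q^*=\tfrac{1}{256}\bigl(3p_{-2}-25p_{-1}+150p_0+150p_1-25p_2+3p_3\bigr).$$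
   Context: The value $q^*$ is the 6-point Deslauriers--Dubuc stencil $[3,-25,150,150,-25,3]/256$ applied to the six reference values. The quantities $\kappa_k$ are discrete curvatures (second differences divided by $h^2$ at spacing $h=1/2$), and $E$ is called the discrete biharmonic energy. *)

theory Defs
  imports "HOL-Analysis.Convex" "HOL-Computational_Algebra.Polynomial"
begin

definition strictly_convex_on :: "'a::real_vector set \<Rightarrow> ('a \<Rightarrow> real) \<Rightarrow> bool" where
  "strictly_convex_on S f \<longleftrightarrow> convex S \<and>
     (\<forall>x\<in>S. \<forall>y\<in>S. \<forall>t. x \<noteq> y \<and> 0 < t \<and> t < 1 \<longrightarrow>
        f ((1 - t) *\<^sub>R x + t *\<^sub>R y) < (1 - t) * f x + t * f y)"

definition quadratic_function :: "(real \<Rightarrow> real) \<Rightarrow> bool" where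
  "quadratic_function f \<longleftrightarrow> (\<exists>a b c. a \<noteq> 0 \<and> (\<forall>x. f x = a * x\<^sup>2 + b * x + c))"

text \<open>
  The reference scalars are the values of a function on the integers, of which only those
  at the positions -2, ..., 3 are ever used.
\<close>

definition interpolates :: "(int \<Rightarrow> real) \<Rightarrow> real poly \<Rightarrow> bool" where
  "interpolates p P \<longleftrightarrow> degree P \<le> 5 \<and> (\<forall>i\<in>{-2..3}. poly P (of_int i) = p i)"

definition interpolant :: "(int \<Rightarrow> real) \<Rightarrow> real poly" where
  "interpolant p = (THE P. interpolates p P)"

text \<open>
  The sequence \<open>x\<^sub>0, ..., x\<^sub>1\<^sub>0\<close>, at the half-integer spaced positions -2, -3/2, ..., 3;
  it is meaningful for indices up to 10 only.
\<close>

definition refined :: "(int \<Rightarrow> real) \<Rightarrow> real \<Rightarrow> nat \<Rightarrow> real" where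
  "refined p q k =
     [p (-2), poly (interpolant p) (-3/2),
      p (-1), poly (interpolant p) (-1/2),
      p 0, q,
      p 1, poly (interpolant p) (3/2),
      p 2, poly (interpolant p) (5/2),
      p 3] ! k"

text \<open>
  The factor 4 is \<open>1 / h\<^sup>2\<close> for the spacing \<open>h = 1/2\<close>. Because of truncated subtraction,
  the definition is meaningful for \<open>k \<ge> 1\<close> only.
\<close>

definition curvature :: "(nat \<Rightarrow> real) \<Rightarrow> nat \<Rightarrow> real" where
  "curvature x k = 4 * (x (k + 1) - 2 * x k + x (k - 1))"

definition biharmonic_energy :: "(int \<Rightarrow> real) \<Rightarrow> real \<Rightarrow> real" where
  "biharmonic_energy p q =
     (let \<kappa> = curvature (refined p q)
      in (\<kappa> 4 - \<kappa> 3)\<^sup>2 + (\<kappa> 5 - \<kappa> 4)\<^sup>2 + (\<kappa> 6 - \<kappa> 5)\<^sup>2 + (\<kappa> 7 - \<kappa> 6)\<^sup>2)"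

end

theory Submission
  imports Defs
begin

text \<open>
  The energy is a quadratic in \<open>q\<close> with leading coefficient \<open>320 = 4\<^sup>2 + 12\<^sup>2 + 12\<^sup>2 + 4\<^sup>2\<close>, and its
  derivative is a multiple of the sixth difference of \<open>x\<^sub>2, ..., x\<^sub>8\<close>. At the value at 1/2 of the
  interpolating quintic, these seven numbers are samples of that quintic, so the sixth difference
  vanishes.
\<close>

text \<open>Newton's incremental construction: each new node is handled by adding a multiple of the
  nodal polynomial of the earlier ones.\<close>

lemma interpolation_exists:
  fixes f :: "'a::field \<Rightarrow> 'a"
  assumes "finite S"
  shows "\<exists>P. degree P \<le> card S - 1 \<and> (\<forall>x\<in>S. poly P x = f x)"
  using assms
proof (induction S)
  case empty
  \<comment> \<open>With no nodes the degree bound \<open>card S - 1\<close> truncates to 0, which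
    the zero polynomial meets.\<close>
  show ?case by (intro exI[of _ 0]) auto
next
  case (insert a S)
  then obtain P where P: "degree P \<le> card S - 1" "\<forall>x\<in>S. poly P x = f x"
    by blast
  define N where "N = (\<Prod>x\<in>S. [:-x, 1:])"
  \<comment> \<open>\<open>N\<close> vanishes on \<open>S\<close> but not at \<open>a\<close>, since
    \<open>a\<close> is a new node. The correction thus repairs the value at \<open>a\<close> and
    leaves the others alone.\<close>
  define Q where "Q = P + smult ((f a - poly P a) / poly N a) N"
  have N: "poly N x = (\<Prod>y\<in>S. x - y)" for x
    by (simp add: N_def poly_prod)
  have "degree N \<le> card S"
    using degree_prod_sum_le[OF insert.hyps(1), of "\<lambda>x. [:-x, 1:]"] by (simp add: N_def)
  then have "degree Q \<le> card S"
    unfolding Q_def using P(1) by (intro degree_add_le order_trans[OF degree_smult_le]) linarith+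
  moreover have "poly Q a = f a"
    using insert.hyps by (simp add: Q_def N)
  moreover have "poly Q x = f x" if "x \<in> S" for x
    using P(2) that prod_zero[OF insert.hyps(1), of "\<lambda>y. x - y"] by (simp add: Q_def N)
  ultimately show ?case
    using insert.hyps by (intro exI[of _ Q]) simp
qed

lemma card_sample_points: "card (real_of_int ` {-2..3}) = 6"
  by (subst card_image) (simp_all add: inj_on_def)

text \<open>The floor extends the integer data to a function on the reals that agrees with
  \<open>p\<close> at the nodes.\<close>

lemmas quintic_interpolation_exists =
  interpolation_exists[of "real_of_int ` {-2..3}" "\<lambda>x. p \<lfloor>x\<rfloor>" for p, simplified]

lemma interpolates_exists: "\<exists>P. interpolates p P"
  using quintic_interpolation_exists[of p]
  by (simp add: interpolates_def card_sample_points)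

text \<open>Six nodes determine a polynomial of degree at most 5.\<close>

lemma interpolates_unique:
  assumes "interpolates p P" and "interpolates p Q"
  shows "P = Q"
proof (rule poly_eqI_degree)
  show "poly P x = poly Q x" if "x \<in> real_of_int ` {-2..3}" for x
    using that assms by (elim imageE) (simp add: interpolates_def)
qed (use assms in \<open>simp_all add: interpolates_def card_sample_points\<close>)

lemma interpolates_interpolant: "interpolates p (interpolant p)"
  unfolding interpolant_def
  by (rule theI') (blast intro: interpolates_exists interpolates_unique)

lemma degree_interpolant: "degree (interpolant p) \<le> 5"
  using interpolates_interpolant[of p] by (simp add: interpolates_def)

lemma poly_interpolant_of_int:
  "i \<in> {-2..3} \<Longrightarrow> poly (interpolant p) (of_int i) = p i"
  using interpolates_interpolant[of p] by (simp add: interpolates_def)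

text \<open>Expanding up to index 5, whatever the actual degree, turns evaluation into an expression
  in six coefficients, as needed for ring identities.\<close>

lemma poly_quintic:
  fixes P :: "'a::comm_ring_1 poly"
  assumes "degree P \<le> 5"
  shows "poly P x = coeff P 0 + x * (coeff P (Suc 0) + x * (coeff P 2 + x * (coeff P 3
    + x * (coeff P 4 + x * coeff P 5))))"
proof -
  have "poly P x = (\<Sum>i\<le>5. coeff P i * x ^ i)"
    unfolding poly_altdef
    by (rule sum.mono_neutral_left) (use assms in \<open>auto simp: coeff_eq_0\<close>)
  then show ?thesis
    by (simp add: eval_nat_numeral algebra_simps)
qed

lemmas poly_quintic_integers =
  poly_quintic[where x = "-2 :: real", simplified] poly_quintic[where x = "-1 :: real", simplified]
  poly_quintic[where x = "0 :: real", simplified] poly_quintic[where x = "1 :: real", simplified]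
  poly_quintic[where x = "2 :: real", simplified] poly_quintic[where x = "3 :: real", simplified]

lemma interpolant_values:
  fixes p :: "int \<Rightarrow> real"
  shows "poly (interpolant p) (-3/2) =
      1/256 * (63 * p (-2) + 315 * p (-1) - 210 * p 0 + 126 * p 1 - 45 * p 2 + 7 * p 3)"
    and "poly (interpolant p) (-1/2) =
      1/256 * (- 7 * p (-2) + 105 * p (-1) + 210 * p 0 - 70 * p 1 + 21 * p 2 - 3 * p 3)"
    and "poly (interpolant p) (3/2) =
      1/256 * (- 3 * p (-2) + 21 * p (-1) - 70 * p 0 + 210 * p 1 + 105 * p 2 - 7 * p 3)"
    and "poly (interpolant p) (5/2) =
      1/256 * (7 * p (-2) - 45 * p (-1) + 126 * p 0 - 210 * p 1 + 315 * p 2 + 63 * p 3)"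
proof -
  \<comment> \<open>Once the data are read as values of the interpolant, each stencil becomes a
    linear identity in its six coefficients, so no linear system has to be solved.\<close>
  have p: "p (-2) = poly (interpolant p) (-2)" "p (-1) = poly (interpolant p) (-1)"
    "p 0 = poly (interpolant p) 0" "p 1 = poly (interpolant p) 1"
    "p 2 = poly (interpolant p) 2" "p 3 = poly (interpolant p) 3"
    by (simp_all flip: poly_interpolant_of_int)
  show "poly (interpolant p) (-3/2) =
      1/256 * (63 * p (-2) + 315 * p (-1) - 210 * p 0 + 126 * p 1 - 45 * p 2 + 7 * p 3)"
    and "poly (interpolant p) (-1/2) =
      1/256 * (- 7 * p (-2) + 105 * p (-1) + 210 * p 0 - 70 * p 1 + 21 * p 2 - 3 * p 3)"
    and "poly (interpolant p) (3/2) =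
      1/256 * (- 3 * p (-2) + 21 * p (-1) - 70 * p 0 + 210 * p 1 + 105 * p 2 - 7 * p 3)"
    and "poly (interpolant p) (5/2) =
      1/256 * (7 * p (-2) - 45 * p (-1) + 126 * p 0 - 210 * p 1 + 315 * p 2 + 63 * p 3)"
    unfolding p poly_quintic_integers[OF degree_interpolant]
    unfolding poly_quintic[OF degree_interpolant] by algebra+
qed

(* The simplifier rewrites -1/2 to - (1/2); minus_divide_left restores it. *)
lemmas biharmonic_energy_expand =
  biharmonic_energy_def[unfolded Let_def curvature_def refined_def, simplified, unfolded minus_divide_left]

text \<open>Completing the square. The minimal value is left as the energy at \<open>q0\<close>, so
  it need not be computed.\<close>

lemma biharmonic_energy_vertex_form:
  fixes p :: "int \<Rightarrow> real"
  defines "q0 \<equiv> 1/256 * (3 * p (-2) - 25 * p (-1) + 150 * p 0 + 150 * p 1 - 25 * p 2 + 3 * p 3)"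
  shows "biharmonic_energy p q = 320 * (q - q0)\<^sup>2 + biharmonic_energy p q0"
proof -
  \<comment> \<open>The vanishing sixth difference at spacing 1/2, centred at \<open>q0\<close> and
    solved for its last sample. Eliminating \<open>p 2\<close> by it cancels the term linear in
    \<open>q - q0\<close>, with \<open>q0\<close> and the interpolated values kept as atoms.\<close>
  have sixth_difference: "p 2 = 6 * poly (interpolant p) (3/2) - 15 * p 1 + 20 * q0 - 15 * p 0
      + 6 * poly (interpolant p) (-1/2) - p (-1)"
    unfolding interpolant_values q0_def by algebra
  show ?thesis
    unfolding biharmonic_energy_expand sixth_difference by algebra
qed

lemma quadratic_function_vertex_form:
  assumes "\<And>x. f x = a * (x - x0)\<^sup>2 + c" and "a \<noteq> 0"
  shows "quadratic_function f"
  unfolding quadratic_function_def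
  by (rule exI[of _ a], rule exI[of _ "- 2 * a * x0"], rule exI[of _ "a * x0\<^sup>2 + c"])
     (use assms in \<open>auto simp: power2_eq_square algebra_simps\<close>)

lemma strictly_convex_on_vertex_form:
  fixes f :: "real \<Rightarrow> real"
  assumes f: "\<And>x. f x = a * (x - x0)\<^sup>2 + c" and "a > 0"
  shows "strictly_convex_on UNIV f"
  unfolding strictly_convex_on_def
proof (intro conjI ballI allI impI)
  fix x y t :: real
  assume t: "x \<noteq> y \<and> 0 < t \<and> t < 1"
  \<comment> \<open>The Jensen gap of a quadratic depends only on \<open>a\<close>, \<open>t\<close>
    and \<open>x - y\<close>; the vertex and the constant cancel.\<close>
  have "(1 - t) * f x + t * f y - f ((1 - t) *\<^sub>R x + t *\<^sub>R y) = a * (t * (1 - t) * (x - y)\<^sup>2)"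
    unfolding f real_scaleR_def by algebra
  also have "\<dots> > 0"
    using t \<open>a > 0\<close> by simp
  finally show "f ((1 - t) *\<^sub>R x + t *\<^sub>R y) < (1 - t) * f x + t * f y"
    by simp
qed simp

text \<open>The equivalence gives both that the vertex is a minimiser and that there is no other:
  away from \<open>x0\<close> the square term is positive.\<close>

lemma is_arg_min_vertex_form:
  fixes f :: "real \<Rightarrow> real"
  assumes f: "\<And>x. f x = a * (x - x0)\<^sup>2 + c" and "a > 0"
  shows "is_arg_min f (\<lambda>_. True) x \<longleftrightarrow> x = x0"
proof
  assume "is_arg_min f (\<lambda>_. True) x"
  then have "\<not> f x0 < f x"
    by (simp add: is_arg_min_def)
  then show "x = x0"
    using \<open>a > 0\<close> by (simp add: f zero_less_mult_iff)
next
  assume "x = x0"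
  then show "is_arg_min f (\<lambda>_. True) x"
    using \<open>a > 0\<close> by (simp add: is_arg_min_def f mult_less_0_iff not_less)
qed

theorem theorem1:
  fixes p :: "int \<Rightarrow> real"
  shows "(\<exists>!P. interpolates p P) \<and>
    poly (interpolant p) (-3/2) =
      1/256 * (63 * p (-2) + 315 * p (-1) - 210 * p 0 + 126 * p 1 - 45 * p 2 + 7 * p 3) \<and>
    poly (interpolant p) (-1/2) =
      1/256 * (- 7 * p (-2) + 105 * p (-1) + 210 * p 0 - 70 * p 1 + 21 * p 2 - 3 * p 3) \<and>
    poly (interpolant p) (3/2) =
      1/256 * (- 3 * p (-2) + 21 * p (-1) - 70 * p 0 + 210 * p 1 + 105 * p 2 - 7 * p 3) \<and>
    poly (interpolant p) (5/2) =
      1/256 * (7 * p (-2) - 45 * p (-1) + 126 * p 0 - 210 * p 1 + 315 * p 2 + 63 * p 3) \<and>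
    quadratic_function (biharmonic_energy p) \<and>
    strictly_convex_on UNIV (biharmonic_energy p) \<and>
    (\<forall>q. is_arg_min (biharmonic_energy p) (\<lambda>_. True) q \<longleftrightarrow>
       q = 1/256 * (3 * p (-2) - 25 * p (-1) + 150 * p 0 + 150 * p 1 - 25 * p 2 + 3 * p 3))"
  by (intro conjI allI ex_ex1I interpolates_exists interpolates_unique interpolant_values
      quadratic_function_vertex_form[OF biharmonic_energy_vertex_form]
      strictly_convex_on_vertex_form[OF biharmonic_energy_vertex_form]
      is_arg_min_vertex_form[OF biharmonic_energy_vertex_form]) simp_all

end
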